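(* Let $p$ be an odd prime and $n\ge k\ge 1$ integers such that $r=(n-k)/(p-1)$ is a nonnegative integer. Then: (a) $s(n,k)$ is a minimum zero case (MZC) if and only if $p\nmid\binom{k-1}{r}$. (b) $s(n,k)$ is a shifted minimum zero case (SMZC) if and only if $p\nmid\binom{k}{r}$. (c) If $\nu_p(n)\le\nu_p(k)$, then $s(n-1,k-1)$ is a shifted almost minimum zero case (SAMZC) if and only if $s(n,k)$ is an almost minimum zero case (AMZC), and if these cases hold, then $\nu_p(s(n,k))=\nu_p(s(n-1,k-1))$. (d) If instead $\nu_p(k)<\nu_p(n)$, then $s(n,k)$ is a SAMZC if and only if $s(n+1,k+1)$ is an AMZC, and if these cases hold, then $\nu_p(s(n,k))=\nu_p(s(n+1,k+1))$.
   Context: $s(n,k)$ is the (unsigned) Stirling number of the first kind, defined by $x(x-1)\cdots(x-n+1)=\sum_{k=0}^n(-1)^{n-k}s(n,k)x^k$. $\sigma_p(m)$ is the sum of the base $p$ digits of $m\ge 0$; $\nu_p$ is the $p$-adic valuation, with $\nu_p(0)=\infty$. Higher order Bernoulli polynomials $B_m^{(l)}(x)$ ($m\ge 0$, $l\in\mathbb Z$) are defined by $\left(\frac{t}{e^t-1}\right)^l e^{tx}=\sum_{m\ge 0}B_m^{(l)}(x)\frac{t^m}{m!}$; $B_m^{(l)}(x)$ is monic of degree $m$ with rational coefficients, and $B_m^{(l)}=B_m^{(l)}(0)$. The maximum pole (with respect to $p$) of a nonzero rational polynomial is the integer $M$ such that $-M$ is the minimum of the $p$-adic valuations of its coefficients.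 One has $s(n,k)=\binom{n-1}{k-1}B_{n-k}^{(n)}=\binom nk B_{n-k}^{(n+1)}(1)$. With $M,M'$ the maximum poles of $B_{n-k}^{(n)}(x)$ and $B_{n-k}^{(n+1)}(x)$ respectively: $s(n,k)$ is a MZC if $\nu_p(s(n,k))=(\sigma_p(k-1)-\sigma_p(n-1))/(p-1)$; a SMZC if $\nu_p(s(n,k))=(\sigma_p(k)-\sigma_p(n))/(p-1)$; an AMZC if $\nu_p(s(n,k))=\nu_p\left(\binom{n-1}{k-1}\right)-M$; a SAMZC if $\nu_p(s(n,k))=\nu_p\left(\binom nk\right)-M'$ (the shifted notions make sense for $n\ge k\ge 0$). *)

theory Defs
  imports
    "HOL-Computational_Algebra.Computational_Algebra"
    "HOL-Combinatorics.Stirling"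
    "HOL-Library.Extended_Real"
begin

text \<open>
  The library function \<open>stirling\<close> is the unsigned Stirling number of the first kind; the next
  lemma is its description as a coefficient of the falling factorial.
\<close>

lemma falling_factorial_stirling:
  fixes x :: "'a :: comm_ring_1"
  shows "(\<Prod>i<n. x - of_nat i) = (\<Sum>k\<le>n. (- 1) ^ (n - k) * of_nat (stirling n k) * x ^ k)"
proof -
  have "(\<Prod>i<n. x - of_nat i) = (- 1) ^ n * (\<Prod>i<n. - x + of_nat i)"
    by (induction n) (simp_all add: algebra_simps)
  also have "(\<Prod>i<n. - x + of_nat i) = pochhammer (- x) n"
    by (simp add: pochhammer_prod atLeast0LessThan)
  also have "\<dots> = (\<Sum>k\<le>n. of_nat (stirling n k) * (- x) ^ k)"
    by (simp add: stirling_pochhammer)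
  also have "(- 1) ^ n * \<dots> = (\<Sum>k\<le>n. (- 1) ^ (n - k) * of_nat (stirling n k) * x ^ k)"
    unfolding sum_distrib_left
  proof (rule sum.cong[OF refl])
    fix k assume "k \<in> {..n}"
    then have "(- 1 :: 'a) ^ n = (- 1) ^ (n - k) * (- 1) ^ k"
      by (simp flip: power_add)
    moreover have "(- x) ^ k = (- 1) ^ k * x ^ k"
      by (rule power_minus)
    moreover have "(- 1 :: 'a) ^ k * (- 1) ^ k = 1"
      by (simp flip: power_mult_distrib)
    ultimately show "(- 1) ^ n * (of_nat (stirling n k) * (- x) ^ k) =
        (- 1) ^ (n - k) * of_nat (stirling n k) * x ^ k"
      by (simp add: mult_ac)
  qed
  finally show ?thesis .
qed

text \<open>
  For \<open>p \<ge> 2\<close> one has \<open>m < p ^ i\<close> whenever \<open>i \<ge> m\<close>, so the range \<open>i \<le> m\<close> covers all nonzero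
  base \<open>p\<close> digits of \<open>m\<close>.
\<close>

definition digit_sum :: "nat \<Rightarrow> nat \<Rightarrow> nat" where
  "digit_sum p m = (\<Sum>i\<le>m. m div p ^ i mod p)"

text \<open>Only meaningful for \<open>x \<noteq> 0\<close>; the value \<open>\<infinity>\<close> at \<open>0\<close> is supplied by \<open>nu\<close> below.\<close>

definition rat_val :: "nat \<Rightarrow> rat \<Rightarrow> int" where
  "rat_val p x = int (multiplicity (int p) (fst (quotient_of x))) -
                 int (multiplicity (int p) (snd (quotient_of x)))"

definition nu :: "nat \<Rightarrow> rat \<Rightarrow> ereal" where
  "nu p x = (if x = 0 then \<infinity> else ereal (real_of_int (rat_val p x)))"

text \<open>
  The exponent \<open>l\<close> may be negative: \<open>t / (e ^ t - 1)\<close> has constant coefficient \<open>1\<close>, so its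
  \<open>inverse\<close> as a formal power series is a genuine inverse.
\<close>

definition bernoulli_base :: "int \<Rightarrow> rat fps" where
  "bernoulli_base l = (fps_X / (fps_exp 1 - 1)) powi l"

text \<open>
  \<open>e ^ (t x)\<close> as a power series in \<open>t\<close> whose coefficients are polynomials in \<open>x\<close>
  (\<open>fps_exp\<close> is not available over the coefficient ring \<open>rat poly\<close>).
\<close>

definition exp_tx :: "rat poly fps" where
  "exp_tx = Abs_fps (\<lambda>m. monom (1 / fact m) m)"

definition bernoulli_poly :: "nat \<Rightarrow> int \<Rightarrow> rat poly" where
  "bernoulli_poly m l =
     fact m * fps_nth (Abs_fps (\<lambda>i. [:fps_nth (bernoulli_base l) i:]) * exp_tx) m"

text \<open>The next two lemmas confirm that these definitions give the usual generating function.\<close>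

lemma fps_X_over_exp_minus_one:
  "(fps_X / (fps_exp 1 - 1)) * (fps_exp 1 - 1) = (fps_X :: rat fps)"
  "fps_nth (fps_X / (fps_exp 1 - 1) :: rat fps) 0 = 1"
proof -
  have nz: "fps_exp 1 - 1 \<noteq> (0 :: rat fps)"
  proof
    assume "fps_exp 1 - 1 = (0 :: rat fps)"
    then have "fps_nth (fps_exp 1 - 1 :: rat fps) 1 = 0" by simp
    then show False by simp
  qed
  have sd: "subdegree (fps_exp 1 - 1 :: rat fps) = 1"
    by (rule subdegreeI) auto
  show *: "(fps_X / (fps_exp 1 - 1)) * (fps_exp 1 - 1) = (fps_X :: rat fps)"
    using nz sd by (intro dvd_div_mult_self) (simp add: fps_dvd_iff)
  show "fps_nth (fps_X / (fps_exp 1 - 1) :: rat fps) 0 = 1"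
    using arg_cong[OF *, of "\<lambda>f. fps_nth f 1"] by (simp add: fps_mult_nth)
qed

lemma bernoulli_poly_generating_function:
  "Abs_fps (\<lambda>m. poly (bernoulli_poly m l) x / fact m) =
     (fps_X / (fps_exp 1 - 1)) powi l * fps_exp x"
proof (rule fps_ext)
  fix m
  have fact_poly: "poly (fact m) x = fact m"
    by (metis of_nat_fact poly_of_nat)
  show "fps_nth (Abs_fps (\<lambda>m. poly (bernoulli_poly m l) x / fact m)) m =
      fps_nth ((fps_X / (fps_exp 1 - 1)) powi l * fps_exp x) m"
    by (simp add: bernoulli_poly_def bernoulli_base_def exp_tx_def fps_mult_nth fact_poly
        poly_sum poly_monom)
qed

definition max_pole :: "nat \<Rightarrow> rat poly \<Rightarrow> int" where
  "max_pole p f = - Min ((\<lambda>i. rat_val p (coeff f i)) ` {i. coeff f i \<noteq> 0})"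

text \<open>
  \<open>MZC\<close> and \<open>AMZC\<close> are meant for \<open>n \<ge> k \<ge> 1\<close>, the shifted notions \<open>SMZC\<close> and \<open>SAMZC\<close> for
  \<open>n \<ge> k \<ge> 0\<close>. All four are properties of the pair of indices \<open>(n, k)\<close>.
\<close>

definition MZC :: "nat \<Rightarrow> nat \<Rightarrow> nat \<Rightarrow> bool" where
  "MZC p n k \<longleftrightarrow> nu p (of_nat (stirling n k)) =
     ereal ((real (digit_sum p (k - 1)) - real (digit_sum p (n - 1))) / (real p - 1))"

definition SMZC :: "nat \<Rightarrow> nat \<Rightarrow> nat \<Rightarrow> bool" where
  "SMZC p n k \<longleftrightarrow> nu p (of_nat (stirling n k)) =
     ereal ((real (digit_sum p k) - real (digit_sum p n)) / (real p - 1))"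

definition AMZC :: "nat \<Rightarrow> nat \<Rightarrow> nat \<Rightarrow> bool" where
  "AMZC p n k \<longleftrightarrow> nu p (of_nat (stirling n k)) =
     nu p (of_nat ((n - 1) choose (k - 1))) -
     ereal (real_of_int (max_pole p (bernoulli_poly (n - k) (int n))))"

definition SAMZC :: "nat \<Rightarrow> nat \<Rightarrow> nat \<Rightarrow> bool" where
  "SAMZC p n k \<longleftrightarrow> nu p (of_nat (stirling n k)) =
     nu p (of_nat (n choose k)) -
     ereal (real_of_int (max_pole p (bernoulli_poly (n - k) (int n + 1))))"

end

theory Submission
  imports "HOL-Number_Theory.Residue_Primitive_Roots" Defs
begin

text \<open>
  Write \<open>c_i\<close> for the coefficient of \<open>z ^ i\<close> in \<open>(- log (1 - z) / z) ^ (k - 1)\<close> and \<open>m = n - k = r (p - 1)\<close>.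
  Up to quotients of factorials, \<open>s(n - 1, k - 1)\<close> is \<open>c_m\<close> and \<open>s(n, k)\<close> is \<open>\<Sum>i\<le>m. c_i\<close>.
  Since \<open>p ^ e\<close> divides \<open>l + 1\<close> only if \<open>e (p - 1) \<le> l\<close>, with equality only for \<open>l = 0\<close> and
  \<open>l = p - 1\<close>, the number \<open>p ^ r c_m\<close> satisfies Pascal's rule modulo \<open>p\<close>, so it is congruent to
  \<open>k - 1\<close> choose \<open>r\<close>, while the \<open>c_i\<close> with \<open>i < m\<close> have smaller poles. With Legendre's formula
  this gives (a) and (b).

  For (c), let \<open>P\<close> be the Bernoulli polynomial of degree \<open>m\<close> and order \<open>n\<close>. In the basis
  \<open>(x - 1) \<cdots> (x - j)\<close> its coefficients are \<open>\<plusminus> m! c_(m-j) / j!\<close>, and they have the same minimal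
  valuation \<open>\<mu>\<close> as the usual ones because the base change is unitriangular over the integers. Both cases
  ask whether \<open>P\<close> attains \<open>\<mu>\<close>, at \<open>0\<close> and at \<open>1\<close> respectively, so it suffices that every
  \<open>e_j = m! c_(m-j)\<close> with \<open>j \<ge> 1\<close>, and hence \<open>P(0) - P(1)\<close>, has valuation above \<open>\<mu>\<close>.
  For \<open>j \<ge> p\<close> this is due to the factor \<open>j!\<close>. For \<open>j = p - 1\<close> it follows from
  \<open>n (\<Sum>j. e_j / (j + 1)) = k (\<Sum>j. e_j)\<close>, which is where \<open>\<nu>_p(n) \<le> \<nu>_p(k)\<close> enters. For
  \<open>0 < j < p - 1\<close> it follows by downward induction from the substitution
  \<open>z \<mapsto> 1 - (1 - z) ^ a\<close> with a primitive root \<open>a\<close> modulo \<open>p\<close>, which multiplies \<open>log (1 - z)\<close> by \<open>a\<close>.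
  Finally, (d) is (c) for \<open>(n + 1, k + 1)\<close>, since \<open>p\<close> divides \<open>n\<close> and hence not \<open>n + 1\<close>.
\<close>

section \<open>Coefficients of powers of \<open>- log (1 - z) / z\<close>\<close>

text \<open>The series of - log (1 - z). Its constant term is 0 because division by zero yields
  0.\<close>

definition neg_log :: "rat fps" where
  "neg_log = Abs_fps (\<lambda>i. 1 / of_nat i)"

definition neg_log_quot :: "rat fps" where
  "neg_log_quot = Abs_fps (\<lambda>i. 1 / of_nat (Suc i))"

definition log_coeff :: "nat \<Rightarrow> nat \<Rightarrow> rat" where
  "log_coeff K i = fps_nth (neg_log_quot ^ K) i"

lemma neg_log_eq: "neg_log = fps_X * neg_log_quot"
proof (rule fps_ext)
  fix n show "fps_nth neg_log n = fps_nth (fps_X * neg_log_quot) n"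
    by (cases n) (simp_all add: neg_log_def neg_log_quot_def)
qed

lemma neg_log_power_nth: "fps_nth (neg_log ^ K) (K + i) = log_coeff K i"
  by (simp add: neg_log_eq power_mult_distrib fps_X_power_mult_nth log_coeff_def)

lemma neg_log_power_nth_less: "l < K \<Longrightarrow> fps_nth (neg_log ^ K) l = 0"
  by (simp add: neg_log_eq power_mult_distrib fps_X_power_mult_nth)

lemma deriv_neg_log: "(1 - fps_X) * fps_deriv neg_log = 1"
proof (rule fps_ext)
  fix n show "fps_nth ((1 - fps_X) * fps_deriv neg_log) n = fps_nth 1 n"
    by (cases n) (simp_all add: neg_log_def left_diff_distrib del: of_nat_Suc)
qed

text \<open>For L = - log (1 - z), the equation (1 - z) L' = 1 gives (1 - z) (L ^ (K + 1))' = (K +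
  1) L ^ K. Comparing coefficients gives the Stirling recurrence, rescaled by factorials.\<close>

lemma neg_log_power_stirling:
  "fps_nth (neg_log ^ K) N = fact K * of_nat (stirling N K) / fact N"
proof (induction K arbitrary: N)
  case 0
  show ?case by (cases N) simp_all
next
  case (Suc K)
  note IH = Suc
  let ?a = "\<lambda>N. fps_nth (neg_log ^ Suc K) N"
  have "(1 - fps_X) * fps_deriv (neg_log ^ Suc K) =
      of_nat (Suc K) * neg_log ^ K * ((1 - fps_X) * fps_deriv neg_log)"
    unfolding fps_deriv_power' by (simp add: mult_ac del: of_nat_Suc power_Suc)
  then have D: "(1 - fps_X) * fps_deriv (neg_log ^ Suc K) = of_nat (Suc K) * neg_log ^ K"
    by (simp only: deriv_neg_log mult_1_right)
  have rec: "of_nat (Suc N) * ?a (Suc N) - of_nat N * ?a N =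
      of_nat (Suc K) * fps_nth (neg_log ^ K) N" for N
    using arg_cong[OF D, of "\<lambda>f. fps_nth f N"]
    by (cases N) (simp_all add: left_diff_distrib fps_of_nat[symmetric] del: of_nat_Suc power_Suc)
  show ?case
  proof (induction N)
    case 0
    show ?case by (simp add: neg_log_def)
  next
    case (Suc N)
    have "of_nat (Suc N) * ?a (Suc N) = of_nat N * ?a N + of_nat (Suc K) * fps_nth (neg_log ^ K) N"
      using rec[of N] by linarith
    also have "\<dots> = fact (Suc K) * of_nat (stirling (Suc N) (Suc K)) / fact N"
      unfolding Suc IH by (simp add: field_simps)
    finally have "?a (Suc N) = fact (Suc K) * of_nat (stirling (Suc N) (Suc K)) / fact N / of_nat (Suc N)"
      by (metis nonzero_mult_div_cancel_left of_nat_eq_0_iff nat.distinct(2))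
    then show ?case by (simp add: mult.commute)
  qed
qed

lemma log_coeff_stirling:
  "log_coeff K i = fact K * of_nat (stirling (K + i) K) / fact (K + i)"
  using neg_log_power_stirling[of K "K + i"] by (simp add: neg_log_power_nth)

lemma log_coeff_0: "log_coeff K 0 = 1"
  by (simp add: log_coeff_stirling)

lemma sum_log_coeff:
  "(\<Sum>i\<le>m. log_coeff K i) = fact K * of_nat (stirling (Suc (K + m)) (Suc K)) / fact (K + m)"
proof (induction m)
  case 0
  show ?case by (simp add: log_coeff_0)
next
  case (Suc m)
  have "(\<Sum>i\<le>Suc m. log_coeff K i) =
      fact K * of_nat (stirling (Suc (K + m)) (Suc K)) / fact (K + m) + log_coeff K (Suc m)"
    using Suc by simp
  also have "\<dots> = fact K * of_nat (stirling (Suc (Suc (K + m))) (Suc K)) / fact (Suc (K + m))"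
    unfolding log_coeff_stirling by (simp add: divide_simps) (simp add: algebra_simps)
  finally show ?case by simp
qed

lemma log_coeff_Suc:
  "log_coeff (Suc K) j = (\<Sum>i\<le>j. log_coeff K (j - i) / of_nat (Suc i))"
  by (simp add: log_coeff_def fps_mult_nth neg_log_quot_def atMost_atLeast0)

text \<open>Both sides are multiples of s(K + m + 1, K + 1), read once as a single coefficient and
  once as a partial sum. With k = K + 1 and n = k + m this brings in the ratio k / n.\<close>

lemma log_coeff_Suc_eq_sum:
  "of_nat (Suc K + m) * log_coeff (Suc K) m = of_nat (Suc K) * (\<Sum>i\<le>m. log_coeff K i)"
  by (subst sum_log_coeff, subst log_coeff_stirling) (simp add: divide_simps)

section \<open>Substituting 1 - (1 - z) ^ a into the logarithm\<close>

lemma fps_mult_nth_Ints: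
  fixes f g :: "'a :: comm_ring_1 fps"
  assumes "\<And>n. fps_nth f n \<in> \<int>" "\<And>n. fps_nth g n \<in> \<int>"
  shows "fps_nth (f * g) n \<in> \<int>"
  using assms by (auto simp: fps_mult_nth intro!: Ints_sum Ints_mult)

lemma fps_power_nth_Ints:
  fixes f :: "'a :: comm_ring_1 fps"
  assumes "\<And>n. fps_nth f n \<in> \<int>"
  shows "fps_nth (f ^ e) n \<in> \<int>"
proof (induction e arbitrary: n)
  case (Suc e)
  then show ?case using assms by (simp add: fps_mult_nth_Ints)
qed simp

text \<open>Both sides have constant term 0 and the same derivative.\<close>

lemma neg_log_compose:
  assumes "a > 0"
  shows "neg_log oo (1 - (1 - fps_X) ^ a) = of_nat a * neg_log"
proof -
  define g :: "rat fps" where "g = 1 - (1 - fps_X) ^ a"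
  have g0: "fps_nth g 0 = 0" by (simp add: g_def fps_power_zeroth)
  let ?G = "fps_deriv neg_log"
  have "((1 - fps_X) * ?G) oo g = 1" by (simp add: deriv_neg_log)
  then have *: "(1 - fps_X) ^ a * (?G oo g) = 1"
    using g0 by (simp add: fps_compose_mult_distrib fps_compose_sub_distrib g_def)
  have "fps_deriv g = of_nat a * (1 - fps_X) ^ (a - 1)"
    by (simp add: g_def fps_deriv_power')
  \<comment> \<open>The last factor equals 1; it supplies the missing power of 1 - z, so that
    \<open>*\<close> applies without a division.\<close>
  then have "fps_deriv (neg_log oo g) = (?G oo g) * (of_nat a * (1 - fps_X) ^ (a - 1)) * ((1 - fps_X) * ?G)"
    using fps_compose_deriv[OF g0, of neg_log] by (simp only: deriv_neg_log mult_1_right)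
  also have "\<dots> = of_nat a * ?G * ((1 - fps_X) ^ Suc (a - 1) * (?G oo g))"
    by (simp add: mult_ac)
  also have "\<dots> = of_nat a * ?G" using assms * by simp
  also have "\<dots> = fps_deriv (of_nat a * neg_log)" by simp
  finally have "neg_log oo g = fps_const (fps_nth (neg_log oo g) 0 - fps_nth (of_nat a * neg_log) 0) + of_nat a * neg_log"
    by (simp only: fps_deriv_eq_iff)
  then show ?thesis by (simp add: g_def neg_log_def)
qed

text \<open>Comparing coefficients in \<open>(- log (1 - g)) ^ K = a ^ K (- log (1 - z)) ^ K\<close> for
  \<open>g = 1 - (1 - z) ^ a\<close>.\<close>
lemma log_coeff_dilation:
  assumes "a > 0"
  obtains h :: "nat \<Rightarrow> int" where
    "of_nat a ^ K * (1 - of_nat a ^ j) * log_coeff K j = (\<Sum>i<j. log_coeff K i * of_int (h i))"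
proof -
  define g :: "rat fps" where "g = 1 - (1 - fps_X) ^ a"
  have g0: "fps_nth g 0 = 0" by (simp add: g_def fps_power_zeroth)
  have g1: "fps_nth g 1 = of_nat a"
    by (simp add: g_def fps_power_first[unfolded One_nat_def])
  \<comment> \<open>Integrality of \<open>g\<close> is what makes the multipliers \<open>h i\<close>
    integers.\<close>
  have "fps_nth g n \<in> \<int>" for n
    unfolding g_def fps_sub_nth by (intro Ints_diff fps_power_nth_Ints) auto
  then have "fps_nth (g ^ (K + i)) (K + j) \<in> \<int>" for i
    by (rule fps_power_nth_Ints)
  then have "\<exists>h. \<forall>i. fps_nth (g ^ (K + i)) (K + j) = of_int (h i)"
    by (intro choice allI) (auto elim: Ints_cases)
  then obtain h where h: "\<And>i. fps_nth (g ^ (K + i)) (K + j) = of_int (h i)" by blast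
  have "neg_log ^ K oo g = of_nat a ^ K * neg_log ^ K"
    using neg_log_compose[OF assms] fps_compose_power[OF g0, of neg_log K]
    by (simp add: g_def power_mult_distrib)
  then have "of_nat a ^ K * log_coeff K j = fps_nth (neg_log ^ K oo g) (K + j)"
    by (simp add: fps_of_nat[symmetric] fps_const_power neg_log_power_nth)
  also have "\<dots> = (\<Sum>l\<in>{0..K + j}. fps_nth (neg_log ^ K) l * fps_nth (g ^ l) (K + j))"
    by (rule fps_compose_nth)
  also have "\<dots> = (\<Sum>l\<in>{K..K + j}. fps_nth (neg_log ^ K) l * fps_nth (g ^ l) (K + j))"
    by (rule sum.mono_neutral_right) (auto simp: neg_log_power_nth_less)
  also have "\<dots> = (\<Sum>i\<in>{0..j}. log_coeff K i * of_int (h i))"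
    by (rule sum.reindex_bij_witness[of _ "\<lambda>i. K + i" "\<lambda>l. l - K"])
      (auto simp: neg_log_power_nth[symmetric] h[symmetric])
  also have "{0..j} = insert j {..<j}" by auto
  also have "(\<Sum>i\<in>\<dots>. log_coeff K i * of_int (h i)) =
      log_coeff K j * of_int (h j) + (\<Sum>i<j. log_coeff K i * of_int (h i))"
    by simp
  \<comment> \<open>As \<open>g\<close> starts with a z, the lowest coefficient of its power K + j
    is a ^ (K + j). Moving this term to the left creates the factor 1 - a ^ j.\<close>
  also have "of_int (h j) = (of_nat a ^ (K + j) :: rat)"
    using h[of j] startsby_zero_power_nth_same[OF g0, of "K + j"] g1 by simp
  finally show ?thesis
    by (intro that[of h]) (simp add: algebra_simps power_add)
qed

section \<open>Higher order Bernoulli polynomials\<close>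

abbreviation bern_fps :: "rat fps" where
  "bern_fps \<equiv> fps_X / (fps_exp 1 - 1)"

lemma bern_fps_power_mult:
  assumes "j \<le> n"
  shows "bern_fps ^ n * (fps_exp 1 - 1) ^ j = bern_fps ^ (n - j) * fps_X ^ j"
proof -
  have "bern_fps ^ n = bern_fps ^ (n - j) * bern_fps ^ j"
    using assms by (simp flip: power_add)
  then show ?thesis
    by (simp add: mult.assoc fps_X_over_exp_minus_one(1) flip: power_mult_distrib)
qed

lemma fps_X_deriv_bern_fps:
  "fps_X * fps_deriv bern_fps = bern_fps - bern_fps * fps_X - bern_fps * bern_fps"
proof -
  have "fps_deriv (bern_fps * (fps_exp 1 - 1)) = fps_deriv fps_X"
    by (simp only: fps_X_over_exp_minus_one(1))
  then have "fps_deriv bern_fps * (fps_exp 1 - 1) + bern_fps * fps_exp 1 = 1"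
    by (simp add: algebra_simps)
  \<comment> \<open>After this multiplication every e ^ t - 1 meets a factor \<open>bern_fps\<close>
    and can be replaced by t.\<close>
  then have "bern_fps * (fps_deriv bern_fps * (fps_exp 1 - 1) + bern_fps * fps_exp 1) = bern_fps"
    by simp
  then have "(bern_fps * (fps_exp 1 - 1)) * fps_deriv bern_fps +
      bern_fps * (bern_fps * (fps_exp 1 - 1) + bern_fps) = bern_fps"
    by (simp only: algebra_simps) (simp add: algebra_simps)
  then show ?thesis
    unfolding fps_X_over_exp_minus_one(1) by (simp add: algebra_simps)
qed

text \<open>From the differential equation \<open>t \<phi>' = \<phi> - t \<phi> - \<phi>\<^sup>2\<close> of \<open>\<phi> = t / (e ^ t - 1)\<close>; this is the
  Stirling recurrence in disguise.\<close>
lemma bern_fps_power_rec: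
  assumes "n > 0"
  shows "of_nat n * fps_nth (bern_fps ^ Suc n) j =
    (of_nat n - of_nat j) * fps_nth (bern_fps ^ n) j -
      of_nat n * (if j = 0 then 0 else fps_nth (bern_fps ^ n) (j - 1))"
proof -
  obtain n' where n: "n = Suc n'" using assms by (cases n) auto
  have "fps_X * fps_deriv (bern_fps ^ n) =
      of_nat n * bern_fps ^ n' * (fps_X * fps_deriv bern_fps)"
    unfolding fps_deriv_power' n by (simp add: mult_ac del: of_nat_Suc power_Suc)
  also have "\<dots> = of_nat n * (bern_fps ^ n - fps_X * bern_fps ^ n - bern_fps ^ Suc n)"
    unfolding fps_X_deriv_bern_fps n by (simp add: algebra_simps)
  finally have "fps_nth (fps_X * fps_deriv (bern_fps ^ n)) j =
      of_nat n * (fps_nth (bern_fps ^ n) j - fps_nth (fps_X * bern_fps ^ n) j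
        - fps_nth (bern_fps ^ Suc n) j)"
    by (simp add: fps_of_nat[symmetric] del: power_Suc)
  then show ?thesis
    by (cases j) (simp_all add: algebra_simps del: power_Suc)
qed

lemma bern_fps_power_stirling:
  "fps_nth (bern_fps ^ Suc (K + i)) i =
     (- 1) ^ i * (fact K * of_nat (stirling (Suc (K + i)) (Suc K)) / fact (K + i))"
proof (induction "K + i" arbitrary: K i)
  case 0
  then show ?case by (simp add: fps_X_over_exp_minus_one(2))
next
  case (Suc N)
  show ?case
  proof (cases i)
    case 0
    then show ?thesis by (simp add: fps_power_zeroth fps_X_over_exp_minus_one(2) del: power_Suc)
  next
    case i: (Suc i')
    have N: "N = K + i'" using Suc.hyps(2) i by simp
    have IH1: "fps_nth (bern_fps ^ Suc N) i' =
        (- 1) ^ i' * (fact K * of_nat (stirling (Suc N) (Suc K)) / fact N)"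
      using Suc.hyps(1)[OF N] N by simp
    \<comment> \<open>The factor K = (N + 1) - i comes from the recurrence and makes the case
      \<open>K = 0\<close> trivial, where no smaller K is available for the induction
      hypothesis.\<close>
    have IH2: "of_nat K * fps_nth (bern_fps ^ Suc N) i =
        (- 1) ^ i * (fact K * of_nat (stirling (Suc N) K) / fact N)"
    proof (cases K)
      case 0
      then show ?thesis by simp
    next
      case (Suc K')
      then have N': "N = K' + i" using N i by simp
      show ?thesis using Suc.hyps(1)[OF N'] N' Suc by (simp add: field_simps del: power_Suc)
    qed
    have "of_nat (Suc N) - of_nat i = (of_nat K :: rat)" using N i by simp
    then have "of_nat (Suc N) * fps_nth (bern_fps ^ Suc (Suc N)) i =
        (- 1) ^ i * (fact K * of_nat (stirling (Suc N) K) / fact N)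
        - of_nat (Suc N) * ((- 1) ^ i' * (fact K * of_nat (stirling (Suc N) (Suc K)) / fact N))"
      using bern_fps_power_rec[of "Suc N" i] IH1 IH2 i by (simp del: power_Suc of_nat_Suc)
    also have "\<dots> = (- 1) ^ i * (fact K * of_nat (stirling (Suc (Suc N)) (Suc K)) / fact N)"
      by (simp add: i field_simps)
    finally have "fps_nth (bern_fps ^ Suc (Suc N)) i =
        (- 1) ^ i * (fact K * of_nat (stirling (Suc (Suc N)) (Suc K)) / fact N) / of_nat (Suc N)"
      by (metis nonzero_mult_div_cancel_left of_nat_eq_0_iff nat.distinct(2))
    then show ?thesis using N i by (simp add: mult.commute del: power_Suc)
  qed
qed

text \<open>Writing e ^ t = 1 + (e ^ t - 1) adds a term of order one less; the two coefficients are
  partial sums of opposite sign whose difference is a single \<open>log_coeff\<close>.\<close>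

lemma bern_fps_power_exp_nth:
  "fps_nth (bern_fps ^ Suc (K + i) * fps_exp 1) i = (- 1) ^ i * log_coeff K i"
proof -
  have b: "fps_nth (bern_fps ^ Suc (K + i)) i = (- 1) ^ i * (\<Sum>l\<le>i. log_coeff K l)" for i
    by (simp only: bern_fps_power_stirling sum_log_coeff)
  have "bern_fps ^ Suc (K + i) * fps_exp 1 =
      bern_fps ^ Suc (K + i) + bern_fps ^ Suc (K + i) * (fps_exp 1 - 1) ^ 1"
    by (simp add: algebra_simps)
  also have "bern_fps ^ Suc (K + i) * (fps_exp 1 - 1) ^ 1 = fps_X * bern_fps ^ (K + i)"
    by (subst bern_fps_power_mult) simp_all
  finally have *: "fps_nth (bern_fps ^ Suc (K + i) * fps_exp 1) i =
      fps_nth (bern_fps ^ Suc (K + i)) i + fps_nth (fps_X * bern_fps ^ (K + i)) i"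
    by simp
  show ?thesis
  proof (cases i)
    case 0
    then show ?thesis using * b[of 0] by simp
  next
    case (Suc i')
    then show ?thesis using * b[of i] b[of i'] by (simp add: algebra_simps del: power_Suc) (simp add: algebra_simps)
  qed
qed

lemma poly_bernoulli_poly:
  "poly (bernoulli_poly m (int n)) x = fact m * fps_nth (bern_fps ^ n * fps_exp x) m"
  using arg_cong[OF bernoulli_poly_generating_function[of "int n" x], of "\<lambda>f. fps_nth f m"]
  by (simp add: field_simps)

text \<open>With u = e ^ t - 1, the series e ^ (t (N + 1)) is e ^ t (1 + u) ^ N. In its binomial
  expansion each u ^ j cancels j factors of the Bernoulli series and leaves t ^ j.\<close>

lemma poly_bernoulli_poly_Suc:
  "poly (bernoulli_poly m (int (Suc (K + m)))) (of_nat (Suc N)) =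
     fact m * (\<Sum>j\<le>m. of_nat (N choose j) * ((- 1) ^ (m - j) * log_coeff K (m - j)))"
proof -
  let ?n = "Suc (K + m)" and ?u = "fps_exp 1 - 1 :: rat fps"
  have coeff: "fps_nth (bern_fps ^ ?n * fps_exp 1 * ?u ^ j) m =
      (if j \<le> m then (- 1) ^ (m - j) * log_coeff K (m - j) else 0)" for j
  proof (cases "j \<le> m")
    case True
    then have "bern_fps ^ ?n * fps_exp 1 * ?u ^ j = fps_X ^ j * (bern_fps ^ (?n - j) * fps_exp 1)"
      using bern_fps_power_mult[of j ?n] by (simp add: mult_ac del: power_Suc)
    also have "?n - j = Suc (K + (m - j))" using True by simp
    finally have "fps_nth (bern_fps ^ ?n * fps_exp 1 * ?u ^ j) m =
        fps_nth (bern_fps ^ Suc (K + (m - j)) * fps_exp 1) (m - j)"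
      using True by (simp only: fps_X_power_mult_nth) simp
    then show ?thesis using True bern_fps_power_exp_nth[of K "m - j"] by simp
  next
    case False
    \<comment> \<open>The order K + m + 1 can absorb \<open>Suc m\<close> factors of u, and the
      resulting \<open>fps_X ^ Suc m\<close> kills the coefficient at m.\<close>
    then have "?u ^ j = ?u ^ Suc m * ?u ^ (j - Suc m)"
      by (metis not_less_eq_eq le_add_diff_inverse power_add)
    then have "bern_fps ^ ?n * fps_exp 1 * ?u ^ j =
        (bern_fps ^ ?n * ?u ^ Suc m) * fps_exp 1 * ?u ^ (j - Suc m)"
      by (simp add: mult_ac del: power_Suc)
    also have "bern_fps ^ ?n * ?u ^ Suc m = bern_fps ^ (?n - Suc m) * fps_X ^ Suc m"
      by (rule bern_fps_power_mult) simp
    also have "\<dots> * fps_exp 1 * ?u ^ (j - Suc m) =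
        fps_X ^ Suc m * (bern_fps ^ (?n - Suc m) * fps_exp 1 * ?u ^ (j - Suc m))"
      by (simp add: mult_ac del: power_Suc)
    finally have "fps_nth (bern_fps ^ ?n * fps_exp 1 * ?u ^ j) m = 0"
      by (simp only: fps_X_power_mult_nth) simp
    then show ?thesis using False by (simp only: if_False)
  qed
  have "fps_exp (of_nat (Suc N)) = fps_exp 1 * (?u + 1) ^ N"
    by (simp add: fps_exp_power_mult fps_exp_add_mult)
  also have "\<dots> = (\<Sum>j\<le>N. of_nat (N choose j) * (fps_exp 1 * ?u ^ j))"
    unfolding binomial_ring sum_distrib_left by (simp add: mult_ac)
  finally have "fps_nth (bern_fps ^ ?n * fps_exp (of_nat (Suc N))) m =
      (\<Sum>j\<le>N. fps_nth (of_nat (N choose j) * (bern_fps ^ ?n * fps_exp 1 * ?u ^ j)) m)"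
    by (simp only: sum_distrib_left fps_sum_nth mult_ac)
  also have "\<dots> = (\<Sum>j\<le>N. of_nat (N choose j) *
      (if j \<le> m then (- 1) ^ (m - j) * log_coeff K (m - j) else 0))"
    using coeff by (simp add: fps_of_nat[symmetric] del: power_Suc)
  also have "\<dots> = (\<Sum>j\<in>{..N} \<inter> {..m}. of_nat (N choose j) * ((- 1) ^ (m - j) * log_coeff K (m - j)))"
    by (rule sum.mono_neutral_cong_right) auto
  also have "\<dots> = (\<Sum>j\<le>m. of_nat (N choose j) * ((- 1) ^ (m - j) * log_coeff K (m - j)))"
    by (rule sum.mono_neutral_left) auto
  finally show ?thesis by (simp only: poly_bernoulli_poly)
qed

section \<open>The basis of shifted falling factorials\<close>

definition shifted_ffact :: "nat \<Rightarrow> rat poly" where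
  "shifted_ffact j = (\<Prod>i<j. [:- of_nat (Suc i), 1:])"

lemma degree_shifted_ffact: "degree (shifted_ffact j) = j"
  unfolding shifted_ffact_def by (subst degree_prod_eq_sum_degree) auto

lemma lead_coeff_shifted_ffact: "coeff (shifted_ffact j) j = 1"
  using lead_coeff_prod[of "\<lambda>i. [:- of_nat (Suc i), 1 :: rat:]" "{..<j}"] degree_shifted_ffact[of j]
  by (simp add: shifted_ffact_def)

lemma coeff_shifted_ffact_Ints: "coeff (shifted_ffact j) i \<in> \<int>"
proof (induction j arbitrary: i)
  case 0
  show ?case by (simp add: shifted_ffact_def)
next
  case (Suc j)
  have "shifted_ffact (Suc j) = smult (- of_nat (Suc j)) (shifted_ffact j) + pCons 0 (shifted_ffact j)"
    by (simp add: shifted_ffact_def mult.commute[of _ "[:_, _:]"] del: of_nat_Suc)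
  then show ?case
    using Suc by (auto simp: coeff_pCons split: nat.splits simp del: of_nat_Suc
        intro!: Ints_add Ints_mult Ints_minus)
qed

text \<open>The shift by 1 is chosen so that the binomial coefficients in
  \<open>poly_bernoulli_poly_Suc\<close> are values of the basis.\<close>

lemma poly_shifted_ffact_Suc:
  "poly (shifted_ffact j) (of_nat (Suc N)) = fact j * of_nat (N choose j)"
  by (simp add: shifted_ffact_def poly_prod binomial_gbinomial gbinomial_prod_rev atLeast0LessThan)

lemma poly_shifted_ffact_0: "poly (shifted_ffact j) 0 = (- 1) ^ j * fact j"
  by (induction j) (simp_all add: shifted_ffact_def algebra_simps)

text \<open>The two polynomials agree at all positive integers.\<close>

lemma bernoulli_poly_shifted_ffact:
  "bernoulli_poly m (int (Suc (K + m))) =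
     (\<Sum>j\<le>m. smult (fact m * (- 1) ^ (m - j) * log_coeff K (m - j) / fact j) (shifted_ffact j))"
  (is "?P = ?Q")
proof -
  have "poly ?P (of_nat (Suc N)) = poly ?Q (of_nat (Suc N))" for N
    unfolding poly_bernoulli_poly_Suc poly_sum poly_smult poly_shifted_ffact_Suc sum_distrib_left
    by (intro sum.cong) (simp_all add: mult_ac)
  then have "range (\<lambda>N. of_nat (Suc N) :: rat) \<subseteq> {x. poly (?P - ?Q) x = 0}"
    by (auto simp del: of_nat_Suc)
  moreover have "infinite (range (\<lambda>N. of_nat (Suc N) :: rat))"
    by (rule range_inj_infinite) (auto intro: injI)
  ultimately have "infinite {x. poly (?P - ?Q) x = 0}" using finite_subset by blast
  then have "?P - ?Q = 0" using poly_roots_finite by blast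
  then show ?thesis by simp
qed

lemma poly_bernoulli_poly_0:
  "poly (bernoulli_poly m (int (Suc (K + m)))) 0 = (- 1) ^ m * fact m * (\<Sum>i\<le>m. log_coeff K i)"
proof -
  have "poly (bernoulli_poly m (int (Suc (K + m)))) 0 = (\<Sum>j\<le>m. (- 1) ^ m * fact m * log_coeff K (m - j))"
    unfolding bernoulli_poly_shifted_ffact poly_sum poly_smult poly_shifted_ffact_0
  proof (intro sum.cong refl)
    fix j assume "j \<in> {..m}"
    then have "(- 1) ^ m = (- 1 :: rat) ^ (m - j) * (- 1) ^ j" by (simp flip: power_add)
    then show "fact m * (- 1) ^ (m - j) * log_coeff K (m - j) / fact j * ((- 1) ^ j * fact j) =
        (- 1) ^ m * fact m * log_coeff K (m - j)" by simp
  qed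
  also have "\<dots> = (\<Sum>i\<le>m. (- 1) ^ m * fact m * log_coeff K i)"
    by (rule sum.reindex_bij_witness[of _ "\<lambda>i. m - i" "\<lambda>i. m - i"]) auto
  finally show ?thesis by (simp add: sum_distrib_left)
qed

lemma poly_bernoulli_poly_1:
  "poly (bernoulli_poly m (int (Suc (K + m)))) 1 = (- 1) ^ m * fact m * log_coeff K m"
proof -
  have "(\<Sum>j\<le>m. of_nat (0 choose j) * ((- 1) ^ (m - j) * log_coeff K (m - j))) =
      (\<Sum>j\<in>{0}. of_nat (0 choose j) * ((- 1) ^ (m - j) * log_coeff K (m - j)) :: rat)"
    by (rule sum.mono_neutral_right) auto
  then show ?thesis using poly_bernoulli_poly_Suc[of m K 0] by simp
qed

text \<open>The base change is unitriangular over the integers: the top coefficient is read off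
  directly, and subtracting its integral multiples lowers the degree. It is used for the group of
  rationals of valuation at least a given bound.\<close>

lemma shifted_ffact_coeffs_mem:
  fixes d :: "nat \<Rightarrow> rat"
  assumes diff: "\<And>x y. x \<in> M \<Longrightarrow> y \<in> M \<Longrightarrow> x - y \<in> M"
    and mult: "\<And>x a. x \<in> M \<Longrightarrow> x * of_int a \<in> M"
    and coeffs: "\<And>i. coeff (\<Sum>j\<le>m. smult (d j) (shifted_ffact j)) i \<in> M"
    and "j \<le> m"
  shows "d j \<in> M"
  using coeffs \<open>j \<le> m\<close>
proof (induction m)
  case 0
  show ?case using "0.prems"(1)[of 0] "0.prems"(2) lead_coeff_shifted_ffact[of 0] by simp
next
  case (Suc m)
  let ?Q = "\<Sum>j\<le>m. smult (d j) (shifted_ffact j)"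
  have "coeff ?Q (Suc m) = 0"
    by (simp add: coeff_sum coeff_eq_0 degree_shifted_ffact)
  then have top: "d (Suc m) \<in> M"
    using Suc.prems(1)[of "Suc m"] by (simp add: lead_coeff_shifted_ffact)
  have "coeff ?Q i \<in> M" for i
  proof -
    obtain a where "coeff (shifted_ffact (Suc m)) i = of_int a"
      using coeff_shifted_ffact_Ints Ints_cases by blast
    then show ?thesis
      using diff[OF Suc.prems(1)[of i] mult[OF top, of a]] by simp
  qed
  then show ?case using Suc.IH Suc.prems(2) top le_Suc_eq by blast
qed

section \<open>Localization at a prime\<close>

text \<open>Bernoulli's inequality, intended for t = p - 1.\<close>

lemma Suc_mult_le_power: "Suc (e * t) \<le> Suc t ^ e"
proof (induction e)
  case (Suc e)
  have "Suc t * Suc (e * t) \<le> Suc t * Suc t ^ e" using Suc by (rule mult_le_mono2)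
  moreover have "Suc (Suc e * t) \<le> Suc t * Suc (e * t)" by simp
  ultimately show ?case by simp
qed simp

text \<open>The localization of the integers at p. Membership of \<open>x / of_nat p powi e\<close>
  says that x has valuation at least e, and it covers \<open>x = 0\<close> without a case
  distinction.\<close>

definition localZ :: "nat \<Rightarrow> rat set" where
  "localZ p = {of_int a / of_int b | a b. \<not> int p dvd b}"

context
  fixes p :: nat
  assumes prime_p: "prime p"
begin

lemma localZ_I: "x = of_int a / of_int b \<Longrightarrow> \<not> int p dvd b \<Longrightarrow> x \<in> localZ p"
  by (auto simp: localZ_def)

lemma localZ_E:
  assumes "x \<in> localZ p"
  obtains a b where "x = of_int a / of_int b" "\<not> int p dvd b" "b \<noteq> 0"
  using assms by (fastforce simp: localZ_def)

lemma prime_int_p: "prime (int p)"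
  using prime_p by simp

lemma p_nonzero: "p \<noteq> 0" "(of_nat p :: rat) \<noteq> 0"
  using prime_p by (auto dest: prime_gt_0_nat)

lemma localZ_of_int: "of_int a \<in> localZ p"
  by (rule localZ_I[of _ a 1]) (use prime_int_p not_prime_unit in auto)

lemma localZ_of_nat: "of_nat a \<in> localZ p"
  using localZ_of_int[of "int a"] by simp

lemma localZ_0: "0 \<in> localZ p" and localZ_1: "1 \<in> localZ p"
  using localZ_of_int[of 0] localZ_of_int[of 1] by simp_all

lemma localZ_mult:
  assumes "x \<in> localZ p" "y \<in> localZ p" shows "x * y \<in> localZ p"
proof -
  obtain a b where 1: "x = of_int a / of_int b" "\<not> int p dvd b" "b \<noteq> 0" using localZ_E[OF assms(1)] .
  obtain c d where 2: "y = of_int c / of_int d" "\<not> int p dvd d" "d \<noteq> 0" using localZ_E[OF assms(2)] .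
  show ?thesis
    by (rule localZ_I[of _ "a * c" "b * d"]) (use 1 2 prime_int_p in \<open>auto simp: prime_dvd_mult_iff\<close>)
qed

lemma localZ_add:
  assumes "x \<in> localZ p" "y \<in> localZ p" shows "x + y \<in> localZ p"
proof -
  obtain a b where 1: "x = of_int a / of_int b" "\<not> int p dvd b" "b \<noteq> 0" using localZ_E[OF assms(1)] .
  obtain c d where 2: "y = of_int c / of_int d" "\<not> int p dvd d" "d \<noteq> 0" using localZ_E[OF assms(2)] .
  show ?thesis
    by (rule localZ_I[of _ "a * d + c * b" "b * d"])
      (use 1 2 prime_int_p in \<open>auto simp: prime_dvd_mult_iff field_simps\<close>)
qed

lemma localZ_uminus: "x \<in> localZ p \<Longrightarrow> - x \<in> localZ p"
  using localZ_mult[OF localZ_of_int[of "- 1"]] by simp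

lemma localZ_diff: "x \<in> localZ p \<Longrightarrow> y \<in> localZ p \<Longrightarrow> x - y \<in> localZ p"
  using localZ_add[OF _ localZ_uminus, of x y] by simp

lemma localZ_sum: "(\<And>i. i \<in> A \<Longrightarrow> f i \<in> localZ p) \<Longrightarrow> sum f A \<in> localZ p"
  by (induction A rule: infinite_finite_induct) (auto intro: localZ_0 localZ_add)

lemma localZ_power: "x \<in> localZ p \<Longrightarrow> x ^ e \<in> localZ p"
  by (induction e) (auto intro: localZ_1 localZ_mult)

lemma localZ_div_of_int:
  assumes "x \<in> localZ p" "\<not> int p dvd b" shows "x / of_int b \<in> localZ p"
  using localZ_mult[OF assms(1) localZ_I[OF refl assms(2), of 1]] by simp

lemma localZ_div_of_nat: "x \<in> localZ p \<Longrightarrow> \<not> p dvd b \<Longrightarrow> x / of_nat b \<in> localZ p"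
  using localZ_div_of_int[of x "int b"] by simp

lemma of_int_div_p_localZ_iff: "of_int a / of_nat p \<in> localZ p \<longleftrightarrow> int p dvd a"
proof
  assume "of_int a / of_nat p \<in> localZ p"
  then obtain c d where cd: "of_int a / of_nat p = (of_int c / of_int d :: rat)"
    "\<not> int p dvd d" "d \<noteq> 0" by (rule localZ_E)
  then have "(of_int (a * d) :: rat) = of_int (int p * c)"
    using p_nonzero by (simp add: field_simps)
  then have "a * d = int p * c" by (simp only: of_int_eq_iff)
  then have "int p dvd a * d" by simp
  then show "int p dvd a" using cd prime_int_p by (simp add: prime_dvd_mult_iff)
next
  assume "int p dvd a"
  then obtain k where "a = int p * k" by blast
  then show "of_int a / of_nat p \<in> localZ p" using p_nonzero localZ_of_int[of k] by simp
qed

section \<open>The valuation and its link to the localization\<close>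

lemma rat_val_fraction:
  assumes "a \<noteq> 0" "b \<noteq> 0"
  shows "rat_val p (of_int a / of_int b) =
    int (multiplicity (int p) a) - int (multiplicity (int p) b)"
proof -
  obtain c d where q: "quotient_of (of_int a / of_int b) = (c, d)" by fastforce
  have d: "d > 0" using quotient_of_denom_pos[OF q] .
  have "(of_int a / of_int b :: rat) = of_int c / of_int d" using quotient_of_div[OF q] .
  then have "(of_int (a * d) :: rat) = of_int (c * b)"
    using assms d by (simp add: field_simps)
  then have e: "a * d = c * b" by (simp only: of_int_eq_iff)
  then have c: "c \<noteq> 0" using assms d by auto
  have "multiplicity (int p) (a * d) = multiplicity (int p) (c * b)" using e by simp
  then show ?thesis
    using assms c d prime_int_p
    by (simp add: prime_elem_multiplicity_mult_distrib rat_val_def q)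
qed

lemma rat_nonzero_cases:
  fixes x :: rat
  assumes "x \<noteq> 0"
  obtains a b where "x = of_int a / of_int b" "a \<noteq> 0" "b \<noteq> 0"
proof -
  obtain c d where q: "quotient_of x = (c, d)" by fastforce
  show ?thesis
    using that[of c d] quotient_of_div[OF q] quotient_of_denom_pos[OF q] assms by auto
qed

lemma rat_val_mult:
  assumes "x \<noteq> 0" "y \<noteq> 0" shows "rat_val p (x * y) = rat_val p x + rat_val p y"
proof -
  obtain a b where 1: "x = of_int a / of_int b" "a \<noteq> 0" "b \<noteq> 0" using rat_nonzero_cases[OF assms(1)] .
  obtain c d where 2: "y = of_int c / of_int d" "c \<noteq> 0" "d \<noteq> 0" using rat_nonzero_cases[OF assms(2)] .
  have "x * y = of_int (a * c) / of_int (b * d)" using 1 2 by simp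
  then have "rat_val p (x * y) =
      int (multiplicity (int p) (a * c)) - int (multiplicity (int p) (b * d))"
    using rat_val_fraction[of "a * c" "b * d"] 1 2 by simp
  then show ?thesis
    using 1 2 rat_val_fraction[of a b] rat_val_fraction[of c d] prime_int_p
    by (simp add: prime_elem_multiplicity_mult_distrib)
qed

lemma rat_val_of_int: "a \<noteq> 0 \<Longrightarrow> rat_val p (of_int a) = int (multiplicity (int p) a)"
  using rat_val_fraction[of a 1] by simp

lemma multiplicity_of_nat_int:
  assumes "a \<noteq> 0" shows "multiplicity (int p) (int a) = multiplicity p a"
proof (rule multiplicity_eqI)
  show "int p ^ multiplicity p a dvd int a"
    unfolding of_nat_power[symmetric] int_dvd_int_iff by (rule multiplicity_dvd)
  show "\<not> int p ^ Suc (multiplicity p a) dvd int a"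
    unfolding of_nat_power[symmetric] int_dvd_int_iff
    using assms prime_p not_prime_unit by (subst power_dvd_iff_le_multiplicity) auto
qed

lemma rat_val_of_nat: "a \<noteq> 0 \<Longrightarrow> rat_val p (of_nat a) = int (multiplicity p a)"
  using rat_val_of_int[of "int a"] by (simp add: multiplicity_of_nat_int)

lemma rat_val_1: "rat_val p 1 = 0"
  using rat_val_of_nat[of 1] by simp

lemma rat_val_inverse: "x \<noteq> 0 \<Longrightarrow> rat_val p (inverse x) = - rat_val p x"
  using rat_val_mult[of x "inverse x"] by (simp add: rat_val_1)

lemma rat_val_p: "rat_val p (of_nat p) = 1"
  using rat_val_of_nat[of p] prime_p p_nonzero by simp

lemma rat_val_p_power: "rat_val p (of_nat p ^ e) = int e"
  by (induction e) (use p_nonzero in \<open>simp_all add: rat_val_1 rat_val_mult rat_val_p\<close>)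

lemma rat_val_p_powi: "rat_val p (of_nat p powi e) = e"
  by (cases "e \<ge> 0") (use p_nonzero in \<open>simp_all add: power_int_def power_inverse rat_val_p_power rat_val_inverse\<close>)

lemma localZ_iff:
  assumes "x \<noteq> 0" shows "x \<in> localZ p \<longleftrightarrow> rat_val p x \<ge> 0"
proof
  assume "x \<in> localZ p"
  then obtain a b where ab: "x = of_int a / of_int b" "\<not> int p dvd b" "b \<noteq> 0" by (rule localZ_E)
  then have "a \<noteq> 0" using assms by auto
  then show "rat_val p x \<ge> 0"
    using ab rat_val_fraction[of a b] by (simp add: not_dvd_imp_multiplicity_0)
next
  assume v: "rat_val p x \<ge> 0"
  obtain a b where ab: "x = of_int a / of_int b" "a \<noteq> 0" "b \<noteq> 0" using rat_nonzero_cases[OF assms] .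
  define i where "i = multiplicity (int p) a"
  define j where "j = multiplicity (int p) b"
  have ji: "j \<le> i" using v ab rat_val_fraction[of a b] by (simp add: i_def j_def)
  obtain b' where b': "b = int p ^ j * b'" "\<not> int p dvd b'"
    using ab(3) prime_int_p multiplicity_decompose'[of b "int p"] not_prime_unit
    unfolding j_def by metis
  have "int p ^ j dvd a"
    using ji multiplicity_dvd'[of j "int p" a] by (simp add: i_def)
  then obtain a' where a': "a = int p ^ j * a'" by blast
  show "x \<in> localZ p"
    by (rule localZ_I[of _ a' b']) (use ab a' b' p_nonzero in simp_all)
qed

lemma rat_val_div_powi:
  "x \<noteq> 0 \<Longrightarrow> rat_val p (x / of_nat p powi e) = rat_val p x - e"
  using p_nonzero by (simp add: divide_inverse rat_val_mult rat_val_inverse rat_val_p_powi)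

lemma div_powi_localZ_iff:
  "x \<noteq> 0 \<Longrightarrow> x / of_nat p powi e \<in> localZ p \<longleftrightarrow> e \<le> rat_val p x"
  using p_nonzero by (subst localZ_iff) (simp_all add: rat_val_div_powi)

lemma nu_eq_iff:
  "nu p x = ereal (real_of_int e) \<longleftrightarrow>
     x / of_nat p powi e \<in> localZ p \<and> x / of_nat p powi e / of_nat p \<notin> localZ p"
proof (cases "x = 0")
  case True
  then show ?thesis using localZ_0 by (simp add: nu_def)
next
  case False
  have "x / of_nat p powi e / of_nat p = x / of_nat p powi (e + 1)"
    using p_nonzero by (simp add: power_int_add field_simps)
  then show ?thesis
    using False div_powi_localZ_iff[of x e] div_powi_localZ_iff[of x "e + 1"]
    by (auto simp: nu_def)
qed

lemma nu_mult: "nu p (x * y) = nu p x + nu p y"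
  by (auto simp: nu_def rat_val_mult)

text \<open>After division by p ^ e both numbers are p-integral and congruent modulo p, so one is a
  unit exactly when the other is.\<close>

lemma nu_cong_mod_p:
  assumes "x / of_nat p powi e \<in> localZ p"
    and "(y - x) / of_nat p powi e / of_nat p \<in> localZ p"
  shows "nu p x = ereal (real_of_int e) \<longleftrightarrow> nu p y = ereal (real_of_int e)"
proof -
  define a where "a = x / of_nat p powi e"
  define d where "d = (y - x) / of_nat p powi e"
  have y: "y / of_nat p powi e = a + d" by (simp add: a_def d_def diff_divide_distrib)
  have "d = of_nat p * (d / of_nat p)" using p_nonzero by simp
  then have d: "d \<in> localZ p" "d / of_nat p \<in> localZ p"
    using localZ_mult[OF localZ_of_nat[of p], of "d / of_nat p"] assms(2) by (simp_all add: d_def)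
  have "a + d \<in> localZ p" using localZ_add[OF _ d(1)] assms(1) by (simp add: a_def)
  moreover have "(a + d) / of_nat p \<in> localZ p \<longleftrightarrow> a / of_nat p \<in> localZ p"
    using localZ_add[OF _ d(2), of "a / of_nat p"] localZ_diff[OF _ d(2), of "(a + d) / of_nat p"]
    by (auto simp: add_divide_distrib)
  ultimately show ?thesis
    using assms(1) unfolding nu_eq_iff y by (simp add: a_def)
qed

lemma quotient_localZ:
  assumes "nu p (of_nat n) \<le> nu p (of_nat k)" "n \<noteq> 0" "k \<noteq> 0"
  shows "of_nat k / of_nat n \<in> localZ p"
  using assms
  by (subst localZ_iff) (auto simp: nu_def divide_inverse rat_val_mult rat_val_inverse)

section \<open>Digit sums and Legendre's formula\<close>

lemma digit_sum_rec: "digit_sum p m = m mod p + digit_sum p (m div p)"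
proof (cases m)
  case 0
  then show ?thesis by (simp add: digit_sum_def)
next
  case (Suc l)
  have le: "m div p \<le> l"
    using prime_gt_1_nat[OF prime_p] Suc by (metis div_less_dividend less_Suc_eq_le zero_less_Suc)
  have "digit_sum p m = m mod p + (\<Sum>i\<le>l. m div p ^ Suc i mod p)"
    unfolding digit_sum_def Suc by (subst sum.atMost_Suc_shift) simp
  also have "(\<Sum>i\<le>l. m div p ^ Suc i mod p) = (\<Sum>i\<le>l. m div p div p ^ i mod p)"
    by (simp add: div_mult2_eq)
  \<comment> \<open>The surplus indices satisfy m div p < i < p ^ i and contribute zero
    digits.\<close>
  also have "\<dots> = (\<Sum>i\<le>m div p. m div p div p ^ i mod p)"
  proof (rule sum.mono_neutral_right)
    show "\<forall>i\<in>{..l} - {..m div p}. m div p div p ^ i mod p = 0"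
    proof
      fix i assume "i \<in> {..l} - {..m div p}"
      then have "m div p < i" by simp
      also have "i < p ^ i" using prime_gt_1_nat[OF prime_p] by (simp add: power_gt_expt)
      finally show "m div p div p ^ i mod p = 0" by simp
    qed
  qed (use le in auto)
  finally show ?thesis by (simp add: digit_sum_def)
qed

lemma digit_sum_0: "digit_sum p 0 = 0"
  by (simp add: digit_sum_def)

text \<open>Adding 1 turns each trailing digit p - 1 into 0, and the number of these carries is the
  valuation of m + 1.\<close>

lemma digit_sum_Suc:
  "digit_sum p (Suc m) + (p - 1) * multiplicity p (Suc m) = digit_sum p m + 1"
proof (induction m rule: less_induct)
  case (less m)
  have p1: "p > 1" using prime_gt_1_nat[OF prime_p] .
  show ?case
  proof (cases "p dvd Suc m")
    case False
    then have "Suc m mod p = Suc (m mod p)" "Suc m div p = m div p"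
      by (metis mod_Suc mod_0_imp_dvd) (metis False div_Suc mod_0_imp_dvd)
    then show ?thesis
      using False digit_sum_rec[of m] digit_sum_rec[of "Suc m"]
      by (simp add: not_dvd_imp_multiplicity_0)
  next
    case True
    then obtain q where q: "Suc m = p * q" by blast
    then obtain q' where q': "q = Suc q'" by (cases q) auto
    have m: "m = p * q' + (p - 1)" using q q' p1 by simp
    have m': "m = (p - 1) + p * q'" using m by simp
    have "m mod p = p - 1" "m div p = q'"
      unfolding m' mod_mult_self2 using p1 by (simp_all add: div_mult_self2 del: add_diff_assoc2 add_diff_assoc)
    then have 1: "digit_sum p m = p - 1 + digit_sum p q'" using digit_sum_rec[of m] by simp
    have "q' \<le> p * q'" "p - 1 > 0" using p1 by simp_all
    then have "q' < m" using m by linarith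
    then have 2: "digit_sum p q + (p - 1) * multiplicity p q = digit_sum p q' + 1"
      using less q' by blast
    have 3: "digit_sum p (Suc m) = digit_sum p q"
      using digit_sum_rec[of "Suc m"] q p1 by simp
    have "multiplicity p (Suc m) = Suc (multiplicity p q)"
      unfolding q using p1 q' prime_p
      by (intro multiplicity_times_same) (auto dest: not_prime_unit)
    then show ?thesis using 1 2 3 by simp
  qed
qed

lemma legendre_digit_sum: "(p - 1) * multiplicity p (fact m) + digit_sum p m = m"
proof (induction m)
  case 0
  then show ?case by (simp add: digit_sum_0)
next
  case (Suc m)
  have "multiplicity p (fact (Suc m)) = multiplicity p (Suc m) + multiplicity p (fact m)"
    unfolding fact_Suc of_nat_id
    by (rule prime_elem_multiplicity_mult_distrib) (use prime_p in auto)
  then show ?case using Suc digit_sum_Suc[of m] by (simp add: algebra_simps)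
qed


section \<open>Divisibility of the coefficients\<close>

text \<open>Bernoulli's inequality gives e (p - 1) + 1 \<le> p ^ e \<le> l + 1. The second step is
  strict for b > 1, the first for e > 1; b = 1 with e = 0 or e = 1 are the excluded values of
  l.\<close>

lemma multiplicity_Suc_bound:
  assumes "Suc l = p ^ e * b"
  shows "e * (p - 1) \<le> l" and "l \<noteq> 0 \<Longrightarrow> l \<noteq> p - 1 \<Longrightarrow> e * (p - 1) < l"
proof -
  obtain t where t: "p = Suc t" "t > 0"
    using prime_gt_1_nat[OF prime_p] by (cases p) auto
  have pw: "Suc (e * t) \<le> p ^ e" using Suc_mult_le_power[of e t] t by simp
  have b: "b > 0" using assms by (cases b) auto
  have le: "p ^ e \<le> Suc l" unfolding assms using b by simp
  show "e * (p - 1) \<le> l" using pw le t by simp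
  assume l: "l \<noteq> 0" "l \<noteq> p - 1"
  show "e * (p - 1) < l"
  proof (cases "b = 1")
    case False
    then have "p ^ e * 2 \<le> Suc l" unfolding assms using b by (intro mult_le_mono2) simp
    then have "p ^ e < Suc l" using t by (metis Suc_leI assms b less_le mult.right_neutral mult_cancel1 False zero_less_Suc le)
    then show ?thesis using pw t by simp
  next
    case True
    then have l': "Suc l = p ^ e" using assms by simp
    then have "e \<noteq> 0" "e \<noteq> 1" using l t by (auto intro!: Nat.gr0I)
    then obtain e' where e: "e = Suc e'" "e' > 0" by (cases e) auto
    have "Suc t * Suc (e' * t) \<le> p ^ e"
      unfolding e t(1) power_Suc by (intro mult_le_mono2 Suc_mult_le_power)
    moreover have "Suc t * Suc (e' * t) = Suc (e * t) + t * (e' * t)" by (simp add: e)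
    moreover have "t * (e' * t) > 0" using e t by simp
    ultimately have "Suc (e * t) < Suc l" using l' by linarith
    then show ?thesis using t by simp
  qed
qed

lemma p_power_div_Suc:
  obtains e b where "Suc l = p ^ e * b" "\<not> p dvd b"
  using multiplicity_decompose'[of "Suc l" p] prime_p not_prime_unit by (metis nat.distinct(2))

text \<open>In the recursion on K, a denominator l + 1 that costs p ^ e lowers the index by at least
  e (p - 1), so one power of p per p - 1 steps is enough.\<close>

lemma log_coeff_localZ:
  "i < Suc q * (p - 1) \<Longrightarrow> of_nat p ^ q * log_coeff K i \<in> localZ p"
proof (induction K arbitrary: q i)
  case 0
  show ?case using localZ_power[OF localZ_of_nat] localZ_0
    by (cases i) (simp_all add: log_coeff_def)
next
  case (Suc K)
  have "of_nat p ^ q * log_coeff K (i - l) / of_nat (Suc l) \<in> localZ p" if "l \<le> i" for l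
  proof -
    obtain e b where eb: "Suc l = p ^ e * b" "\<not> p dvd b" by (rule p_power_div_Suc)
    have el: "e * (p - 1) \<le> l" using multiplicity_Suc_bound(1)[OF eb(1)] .
    then have "e * (p - 1) < Suc q * (p - 1)" using that Suc.prems by linarith
    then have eq: "e \<le> q" by (metis mult_less_cancel2 less_Suc_eq_le)
    then have "Suc q * (p - 1) = Suc (q - e) * (p - 1) + e * (p - 1)"
      by (metis Suc_diff_le add_mult_distrib le_SucI le_add_diff_inverse2)
    then have "i - l < Suc (q - e) * (p - 1)" using that Suc.prems el by linarith
    then have "of_nat p ^ (q - e) * log_coeff K (i - l) \<in> localZ p" by (rule Suc.IH)
    then have "of_nat p ^ (q - e) * log_coeff K (i - l) / of_nat b \<in> localZ p"
      using localZ_div_of_nat eb(2) by blast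
    moreover have "(of_nat p :: rat) ^ q = of_nat p ^ (q - e) * of_nat p ^ e"
      using eq by (simp flip: power_add)
    ultimately show ?thesis
      unfolding eb(1) using p_nonzero by (simp add: field_simps)
  qed
  then show ?case
    unfolding log_coeff_Suc sum_distrib_left
    by (intro localZ_sum) (auto simp del: of_nat_Suc)
qed

lemma log_coeff_cong_choose:
  "(of_nat p ^ r * log_coeff K (r * (p - 1)) - of_nat (K choose r)) / of_nat p \<in> localZ p"
proof (induction K arbitrary: r)
  case 0
  show ?case
    using prime_gt_1_nat[OF prime_p] localZ_0 by (cases r) (auto simp: log_coeff_def)
next
  case (Suc K)
  show ?case
  proof (cases r)
    case 0
    then show ?thesis using localZ_0 by (simp add: log_coeff_0)
  next
    case r: (Suc q)
    define i where "i = r * (p - 1)"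
    define f where "f l = of_nat p ^ r * (log_coeff K (i - l) / of_nat (Suc l))" for l
    have p1: "p > 1" using prime_gt_1_nat[OF prime_p] .
    \<comment> \<open>For these l the strict bound leaves a spare factor p.\<close>
    have rest: "f l / of_nat p \<in> localZ p" if l: "l \<le> i" "l \<noteq> 0" "l \<noteq> p - 1" for l
    proof -
      obtain e b where eb: "Suc l = p ^ e * b" "\<not> p dvd b" by (rule p_power_div_Suc)
      have el: "e * (p - 1) < l" using multiplicity_Suc_bound(2)[OF eb(1) l(2,3)] .
      then have "e * (p - 1) < r * (p - 1)" using l(1) unfolding i_def by linarith
      then have eq: "e \<le> q" unfolding r by (metis mult_less_cancel2 less_Suc_eq_le)
      then have "r * (p - 1) = Suc (q - e) * (p - 1) + e * (p - 1)"
        unfolding r by (metis Suc_diff_le add_mult_distrib le_SucI le_add_diff_inverse2)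
      then have "i - l < Suc (q - e) * (p - 1)" using l(1) el unfolding i_def by linarith
      then have "of_nat p ^ (q - e) * log_coeff K (i - l) \<in> localZ p" by (rule log_coeff_localZ)
      then have "of_nat p ^ (q - e) * log_coeff K (i - l) / of_nat b \<in> localZ p"
        using localZ_div_of_nat eb(2) by blast
      moreover have "(of_nat p :: rat) ^ r = of_nat p ^ (q - e) * of_nat p ^ e * of_nat p"
        using eq unfolding r power_Suc2 by (simp flip: power_add)
      ultimately show ?thesis
        unfolding f_def eb(1) using p_nonzero by (simp add: field_simps)
    qed
    have "of_nat p ^ r * log_coeff (Suc K) i = (\<Sum>l\<le>i. f l)"
      by (simp only: log_coeff_Suc sum_distrib_left f_def)
    also have "\<dots> = (\<Sum>l\<in>{..i} - {0, p - 1}. f l) + (\<Sum>l\<in>{0, p - 1}. f l)"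
      by (rule sum.subset_diff) (auto simp: i_def r)
    also have "(\<Sum>l\<in>{0, p - 1}. f l) = f 0 + f (p - 1)" using p1 by simp
    \<comment> \<open>Here the denominator is p itself; it lowers r to q and yields the second
      summand of Pascal's rule.\<close>
    also have "f (p - 1) = of_nat p ^ q * log_coeff K (q * (p - 1))"
      using p1 unfolding f_def i_def r by simp
    finally have sum: "of_nat p ^ r * log_coeff (Suc K) i =
        (\<Sum>l\<in>{..i} - {0, p - 1}. f l) + (f 0 + of_nat p ^ q * log_coeff K (q * (p - 1)))" .
    have f0: "f 0 = of_nat p ^ r * log_coeff K (r * (p - 1))" by (simp add: f_def i_def)
    have choose: "Suc K choose r = (K choose r) + (K choose q)" by (simp add: r)
    have "(of_nat p ^ r * log_coeff (Suc K) i - of_nat (Suc K choose r)) / of_nat p =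
        (\<Sum>l\<in>{..i} - {0, p - 1}. f l / of_nat p) +
        ((of_nat p ^ r * log_coeff K (r * (p - 1)) - of_nat (K choose r)) / of_nat p +
         (of_nat p ^ q * log_coeff K (q * (p - 1)) - of_nat (K choose q)) / of_nat p)"
      unfolding sum by (simp add: f0 choose add_divide_distrib diff_divide_distrib sum_divide_distrib del: power_Suc)
    also have "\<dots> \<in> localZ p"
      by (intro localZ_add localZ_sum Suc.IH rest) auto
    finally show ?thesis by (simp add: i_def)
  qed
qed

text \<open>Only the top term matters modulo p: all earlier ones become p-integral already after
  multiplication by p ^ (r - 1).\<close>

lemma sum_log_coeff_cong_choose:
  "(of_nat p ^ r * (\<Sum>i\<le>r * (p - 1). log_coeff K i) - of_nat (K choose r)) / of_nat p \<in> localZ p"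
proof -
  have "of_nat p ^ r * log_coeff K i / of_nat p \<in> localZ p" if "i < r * (p - 1)" for i
  proof (cases r)
    case (Suc q)
    then show ?thesis using log_coeff_localZ[of i q K] that p_nonzero by simp
  qed (use that in simp)
  then have "(\<Sum>i<r * (p - 1). of_nat p ^ r * log_coeff K i / of_nat p) +
      (of_nat p ^ r * log_coeff K (r * (p - 1)) - of_nat (K choose r)) / of_nat p \<in> localZ p"
    by (intro localZ_add localZ_sum log_coeff_cong_choose) auto
  then show ?thesis
    by (simp add: lessThan_Suc_atMost[symmetric] algebra_simps add_divide_distrib diff_divide_distrib
        sum_divide_distrib sum_distrib_left)
qed

section \<open>Valuation criteria for (a) and (b)\<close>

lemma nu_eq_minus_iff:
  assumes "(of_nat p ^ r * x - of_nat c) / of_nat p \<in> localZ p"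
  shows "nu p x = ereal (- real r) \<longleftrightarrow> \<not> p dvd c"
proof -
  have x: "x / of_nat p powi (- int r) = of_nat p ^ r * x"
    by (simp add: power_int_minus divide_inverse mult.commute)
  define d where "d = (of_nat p ^ r * x - of_nat c) / of_nat p"
  have d: "d \<in> localZ p" using assms by (simp add: d_def)
  have eq: "of_nat p ^ r * x = of_nat p * d + of_nat c"
    using p_nonzero by (simp add: d_def)
  then have eq': "of_nat p ^ r * x / of_nat p = d + of_nat c / of_nat p"
    using p_nonzero by (simp add: add_divide_distrib)
  have "of_nat p ^ r * x \<in> localZ p"
    unfolding eq by (intro localZ_add localZ_mult localZ_of_nat d)
  moreover have "of_nat p ^ r * x / of_nat p \<in> localZ p \<longleftrightarrow> of_nat c / of_nat p \<in> localZ p"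
    using localZ_add[OF d, of "of_nat c / of_nat p"]
      localZ_diff[OF _ d, of "of_nat p ^ r * x / of_nat p"]
    unfolding eq' by auto
  moreover have "of_nat c / of_nat p \<in> localZ p \<longleftrightarrow> p dvd c"
    using of_int_div_p_localZ_iff[of "int c"] by simp
  ultimately show ?thesis
    using nu_eq_iff[of x "- int r"] by (simp add: x)
qed

text \<open>By Legendre's formula the valuation of a! / b! is the digit sum quotient plus r, so x
  has to contribute exactly - r.\<close>

lemma nu_fact_quotient_mult_iff:
  assumes "b \<le> a" "a - b = r * (p - 1)"
  shows "nu p (fact a / fact b * x) =
      ereal ((real (digit_sum p b) - real (digit_sum p a)) / (real p - 1)) \<longleftrightarrow>
    nu p x = ereal (- real r)"
proof -
  have p1: "real p - 1 > 0" using prime_gt_1_nat[OF prime_p] by simp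
  have leg: "(real p - 1) * real (multiplicity p (fact m :: nat)) + real (digit_sum p m) = real m" for m
    using arg_cong[OF legendre_digit_sum[of m], of real] prime_gt_1_nat[OF prime_p]
    by (simp add: of_nat_diff)
  have nuf: "nu p (fact m) = ereal (real (multiplicity p (fact m :: nat)))" for m
    using rat_val_of_nat[of "fact m"] by (simp add: nu_def)
  have "nu p (fact a) = nu p (fact b * (fact a / fact b))" by simp
  then have "nu p (fact a) = nu p (fact b) + nu p (fact a / fact b)"
    by (simp only: nu_mult)
  then have q: "nu p (fact a / fact b) =
      ereal (real (multiplicity p (fact a :: nat)) - real (multiplicity p (fact b :: nat)))"
    unfolding nuf by (cases "nu p (fact a / fact b)") auto
  have "real a - real b = real r * (real p - 1)"
    using arg_cong[OF assms(2), of real] assms(1) prime_gt_1_nat[OF prime_p] by (simp add: of_nat_diff)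
  then have "real (digit_sum p b) - real (digit_sum p a) =
      (real p - 1) * (real (multiplicity p (fact a :: nat)) - real (multiplicity p (fact b :: nat)) - real r)"
    using leg[of a] leg[of b] by (simp add: algebra_simps)
  then have "(real (digit_sum p b) - real (digit_sum p a)) / (real p - 1) =
      real (multiplicity p (fact a :: nat)) - real (multiplicity p (fact b :: nat)) - real r"
    using p1 by simp
  then show ?thesis
    unfolding nu_mult q by (cases "nu p x") auto
qed

section \<open>Divisibility of the difference of values for (c) and (d)\<close>

lemma fact_div_Suc_localZ:
  assumes "odd p" "Suc j \<noteq> p"
  shows "fact j / of_nat (Suc j) \<in> localZ p"
proof (cases "p dvd Suc j")
  case False
  then show ?thesis
    using localZ_div_of_nat[OF localZ_of_nat[of "fact j"] False]
    by (simp del: of_nat_Suc)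
next
  case True
  have mult_dvd: "x * y dvd (fact j :: nat)" if "0 < x" "x < y" "y \<le> j" for x y
  proof -
    have "x dvd (fact (y - 1) :: nat)" using that by (intro dvd_fact) auto
    then have "x * y dvd fact (y - 1) * y" by simp
    also have "fact (y - 1) * y = (fact y :: nat)" using that by (cases y) (simp_all add: mult.commute)
    also have "\<dots> dvd fact j" using that by (intro fact_dvd)
    finally show ?thesis .
  qed
  from True obtain b where b: "Suc j = p * b" by blast
  have p3: "p \<ge> 3" using prime_gt_1_nat[OF prime_p] assms(1) by (cases "p = 2") auto
  have "b \<noteq> 0" "b \<noteq> 1" using b assms(2) by (auto intro!: Nat.gr0I)
  then have b2: "b \<ge> 2" by simp
  have "2 * p \<le> p * b" "3 * b \<le> p * b" using b2 p3 by (simp_all add: mult.commute)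
  then have le: "p \<le> j" "b \<le> j" using b b2 p3 by linarith+
  \<comment> \<open>If b differs from p, both are distinct factors of j!. If b = p, the factors p
    and 2 p serve instead, which needs p \<ge> 3: for p = 2 the quotient 3! / 4 is not
    p-integral.\<close>
  have "p * b dvd (fact j :: nat)"
  proof (cases "p = b")
    case False
    then show ?thesis
      using mult_dvd[of p b] mult_dvd[of b p] le b2 p3 by (cases "p < b") (auto simp: mult.commute)
  next
    case True
    have "3 * p \<le> p * b" using True p3 by simp
    then have "2 * p \<le> j" using b p3 by linarith
    then have "p * (2 * p) dvd (fact j :: nat)" using p3 by (intro mult_dvd) auto
    moreover have "p * b dvd p * (2 * p)" using True by simp
    ultimately show ?thesis using dvd_trans by blast
  qed
  then obtain c :: nat where c: "fact j = Suc j * c" unfolding b by blast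
  have "(fact j :: rat) = of_nat (Suc j) * of_nat c"
    using arg_cong[OF c, of "of_nat :: nat \<Rightarrow> rat"] by (simp only: of_nat_fact of_nat_mult)
  then have "fact j / of_nat (Suc j) = (of_nat c :: rat)" by (simp del: of_nat_Suc)
  then show ?thesis using localZ_of_nat by simp
qed

text \<open>\<open>A\<close> scales the coefficients in the shifted basis, up to sign, to p-integral
  numbers; the sum is then the scaled difference P(0) - P(1). The indices j = m - i are split into j
  \<ge> p, j = p - 1 and 0 < j < p - 1.\<close>

lemma log_coeff_sum_divisible:
  assumes odd: "odd p" and m: "m = r * (p - 1)"
    and A: "\<And>j. j \<le> m \<Longrightarrow> A * log_coeff K (m - j) / fact j \<in> localZ p"
    and t: "of_nat (Suc K) / of_nat (Suc K + m) \<in> localZ p"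
  shows "A * (\<Sum>i<m. log_coeff K i) / of_nat p \<in> localZ p"
proof (cases "m = 0")
  case True
  then show ?thesis using localZ_0 by simp
next
  case False
  note Z = localZ_add localZ_diff localZ_mult
    localZ_sum localZ_of_nat localZ_of_int
  have p1: "p > 1" using prime_gt_1_nat[OF prime_p] .
  have pm: "p - 1 \<le> m" using False m by (cases r) auto
  define e where "e j = A * log_coeff K (m - j)" for j
  have e: "e j \<in> localZ p" if "j \<le> m" for j
    using Z(3)[OF A[OF that] Z(5)[of "fact j"]] by (simp add: e_def)
  have high: "e j / of_nat p \<in> localZ p" if "p \<le> j" "j \<le> m" for j
  proof -
    have "p dvd fact j" using that p1 by (intro dvd_fact) auto
    then have "of_nat (fact j) / of_nat p \<in> localZ p"
      using of_int_div_p_localZ_iff[of "fact j"] by (metis of_int_of_nat_eq of_nat_dvd_iff of_nat_fact)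
    then show ?thesis using Z(3)[OF A[OF that(2)]] by (fastforce simp: e_def)
  qed
  \<comment> \<open>The only term of \<open>\<Sum>j. e j / (j + 1)\<close> that can fail to be \<open>p\<close>-integral is \<open>j = p - 1\<close>.\<close>
  have mid: "e (p - 1) / of_nat p \<in> localZ p"
  proof -
    have "of_nat (Suc K + m) * log_coeff (Suc K) m = of_nat (Suc K) * (\<Sum>j\<le>m. log_coeff K (m - j))"
      unfolding log_coeff_Suc_eq_sum
      by (intro arg_cong[where f = "(*) _"] sum.reindex_bij_witness[of _ "\<lambda>i. m - i" "\<lambda>i. m - i"]) auto
    then have "log_coeff (Suc K) m =
        of_nat (Suc K) / of_nat (Suc K + m) * (\<Sum>j\<le>m. log_coeff K (m - j))"
      by (simp add: field_simps)
    then have "A * log_coeff (Suc K) m =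
        of_nat (Suc K) / of_nat (Suc K + m) * (\<Sum>j\<le>m. e j)"
      by (simp only: e_def sum_distrib_left[symmetric] mult.left_commute)
    moreover have "A * log_coeff (Suc K) m = (\<Sum>j\<le>m. e j / of_nat (Suc j))"
      by (simp only: log_coeff_Suc e_def sum_distrib_left times_divide_eq_right)
    moreover have "(\<Sum>j\<le>m. e j / of_nat (Suc j)) =
        e (p - 1) / of_nat p + (\<Sum>j\<in>{..m} - {p - 1}. e j / of_nat (Suc j))"
      using pm p1 by (subst sum.remove[of _ "p - 1"]) auto
    ultimately have "e (p - 1) / of_nat p =
        of_nat (Suc K) / of_nat (Suc K + m) * (\<Sum>j\<le>m. e j) -
          (\<Sum>j\<in>{..m} - {p - 1}. e j / of_nat (Suc j))"
      by linarith
    also have "\<dots> \<in> localZ p"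
    proof (intro Z(2) Z(3) Z(4) t)
      fix j assume j: "j \<in> {..m} - {p - 1}"
      then have "Suc j \<noteq> p" by auto
      then have "A * log_coeff K (m - j) / fact j * (fact j / of_nat (Suc j)) \<in> localZ p"
        using j by (intro Z(3) A fact_div_Suc_localZ odd) auto
      then show "e j / of_nat (Suc j) \<in> localZ p" by (simp add: e_def)
    qed (auto intro: e)
    finally show ?thesis .
  qed
  \<comment> \<open>For a primitive root, 1 - a ^ i is a unit modulo p whenever p - 1 does not
    divide i.\<close>
  obtain a where a: "residue_primroot p a" using prime_primitive_root_exists[OF p1 prime_p] by blast
  then have ord_a: "ord p a = p - 1" and "coprime p a"
    using prime_p by (simp_all add: residue_primroot_def totient_prime)
  then have pa: "\<not> p dvd a" using p1 by (auto simp: coprime_absorb_left)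
  then have a0: "a > 0" by (auto intro: Nat.gr0I)
  \<comment> \<open>Large s come first: the dilation identity expresses the coefficient at i = m - s
    through those at l < i, that is, through \<open>e\<close> at larger indices.\<close>
  have low: "e s / of_nat p \<in> localZ p" if "0 < s" "s \<le> m" for s
    using that
  proof (induction "m - s" arbitrary: s rule: less_induct)
    case less
    show ?case
    proof (cases "s < p - 1")
      case False
      then show ?thesis using high[of s] mid less.prems by (cases "s = p - 1") auto
    next
      case True
      define i where "i = m - s"
      obtain h where h: "of_nat a ^ K * (1 - of_nat a ^ i) * log_coeff K i =
          (\<Sum>l<i. log_coeff K l * of_int (h l))"
        by (rule log_coeff_dilation[OF a0])
      define w where "w = int a ^ K * (1 - int a ^ i)"
      \<comment> \<open>As p - 1 divides m, it would otherwise divide s, which lies strictly between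
        0 and p - 1.\<close>
      have "\<not> (p - 1) dvd i"
      proof
        assume "(p - 1) dvd i"
        moreover have "m = s + i" using less.prems by (simp add: i_def)
        ultimately have "(p - 1) dvd s" using m by (metis dvd_add_left_iff dvd_triv_right)
        then show False using True less.prems by (auto dest: dvd_imp_le)
      qed
      then have "\<not> [a ^ i = 1] (mod p)" by (simp only: ord_divides ord_a not_False_eq_True)
      then have "\<not> [int (a ^ i) = int 1] (mod int p)" by (simp only: cong_int_iff not_False_eq_True)
      then have "\<not> int p dvd 1 - int a ^ i" by (simp add: cong_iff_dvd_diff dvd_diff_commute)
      moreover have "\<not> int p dvd int a ^ K"
        using pa prime_p by (metis of_nat_dvd_iff of_nat_power prime_dvd_power)
      ultimately have w: "\<not> int p dvd w"
        using prime_p by (simp add: w_def prime_dvd_mult_iff)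
      have "of_int w * (A * log_coeff K i / of_nat p) = A * (of_nat a ^ K * (1 - of_nat a ^ i) * log_coeff K i) / of_nat p"
        by (simp add: w_def)
      also have "\<dots> = (\<Sum>l<i. A * log_coeff K l / of_nat p * of_int (h l))"
        unfolding h by (simp add: sum_distrib_left sum_divide_distrib mult_ac)
      also have "\<dots> \<in> localZ p"
      proof (intro Z(3) Z(4) Z(6))
        fix l assume "l \<in> {..<i}"
        then have "e (m - l) / of_nat p \<in> localZ p"
          by (intro less.hyps) (auto simp: i_def)
        then show "A * log_coeff K l / of_nat p \<in> localZ p"
          using \<open>l \<in> {..<i}\<close> by (simp add: e_def i_def)
      qed
      finally have "of_int w * (A * log_coeff K i / of_nat p) / of_int w \<in> localZ p"
        by (rule localZ_div_of_int[OF _ w])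
      moreover have "w \<noteq> 0" using w by auto
      ultimately show ?thesis by (simp add: e_def i_def)
    qed
  qed
  have "A * (\<Sum>i<m. log_coeff K i) / of_nat p = (\<Sum>i<m. e (m - i) / of_nat p)"
    by (simp add: e_def sum_distrib_left sum_divide_distrib)
  also have "\<dots> \<in> localZ p" by (intro Z(4) low) auto
  finally show ?thesis .
qed

section \<open>Stirling numbers as values of Bernoulli polynomials\<close>

lemma stirling_eq_choose_bernoulli_0:
  "of_nat (stirling (Suc (K + m)) (Suc K)) =
     of_nat ((K + m) choose K) * ((- 1) ^ m * poly (bernoulli_poly m (int (Suc (K + m)))) 0)"
  unfolding poly_bernoulli_poly_0 sum_log_coeff by (simp add: binomial_fact)

text \<open>The polynomial and the binomial coefficient are the same as for the value at 0, which
  makes the two notions comparable.\<close>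

lemma stirling_eq_choose_bernoulli_1:
  "of_nat (stirling (K + m) K) =
     of_nat ((K + m) choose K) * ((- 1) ^ m * poly (bernoulli_poly m (int (Suc (K + m)))) 1)"
  unfolding poly_bernoulli_poly_1 log_coeff_stirling by (simp add: binomial_fact)

lemma coeff_div_max_pole_localZ:
  "coeff f i / of_nat p powi (- max_pole p f) \<in> localZ p"
proof (cases "coeff f i = 0")
  case True
  then show ?thesis using localZ_0 by simp
next
  case False
  have "finite {i. coeff f i \<noteq> 0}" by (rule finite_subset[of _ "{..degree f}"]) (auto intro: le_degree)
  then have "- max_pole p f \<le> rat_val p (coeff f i)"
    using False by (auto simp: max_pole_def intro!: Min_le)
  then show ?thesis using div_powi_localZ_iff[OF False] by blast
qed

lemma nu_choose_mult_iff:
  assumes "c > 0"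
  shows "nu p (of_nat c * x) = nu p (of_nat c) - ereal M \<longleftrightarrow> nu p x = ereal (- M)"
  unfolding nu_mult using assms by (cases "nu p x") (auto simp: nu_def)

lemma AMZC_iff_SAMZC:
  assumes odd: "odd p" and m: "m = r * (p - 1)"
    and le: "nu p (of_nat (Suc (K + m))) \<le> nu p (of_nat (Suc K))"
  shows "SAMZC p (K + m) K \<longleftrightarrow> AMZC p (Suc (K + m)) (Suc K)"
    and "SAMZC p (K + m) K \<Longrightarrow> AMZC p (Suc (K + m)) (Suc K) \<Longrightarrow>
      nu p (of_nat (stirling (Suc (K + m)) (Suc K))) = nu p (of_nat (stirling (K + m) K))"
proof -
  define P where "P = bernoulli_poly m (int (Suc (K + m)))"
  define q :: rat where "q = of_nat p powi (- max_pole p P)"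
  have even: "(- 1 :: rat) ^ m = 1" using odd by (simp add: m)
  \<comment> \<open>By definition of the maximum pole, all usual coefficients of \<open>P\<close>
    are p-integral after division by \<open>q\<close>; the base change passes this on to the shifted
    basis.\<close>
  have d: "fact m * (- 1) ^ (m - j) * log_coeff K (m - j) / fact j \<in> {x. x / q \<in> localZ p}"
    if "j \<le> m" for j
  proof (rule shifted_ffact_coeffs_mem[OF _ _ _ that])
    show "coeff (\<Sum>j\<le>m. smult (fact m * (- 1) ^ (m - j) * log_coeff K (m - j) / fact j) (shifted_ffact j)) i
        \<in> {x. x / q \<in> localZ p}" for i
      using coeff_div_max_pole_localZ[of P i]
      by (simp add: q_def P_def flip: bernoulli_poly_shifted_ffact)
  next
    fix x y assume "x \<in> {x. x / q \<in> localZ p}" "y \<in> {x. x / q \<in> localZ p}"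
    then show "x - y \<in> {x. x / q \<in> localZ p}"
      using localZ_diff by (simp add: diff_divide_distrib)
  next
    fix x a assume "x \<in> {x. x / q \<in> localZ p}"
    then show "x * of_int a \<in> {x. x / q \<in> localZ p}"
      using localZ_mult[OF _ localZ_of_int[of a], of "x / q"] by simp
  qed
  have A: "fact m / q * log_coeff K (m - j) / fact j \<in> localZ p" if "j \<le> m" for j
  proof -
    have "(- 1) ^ (m - j) * (fact m * (- 1) ^ (m - j) * log_coeff K (m - j) / fact j / q) \<in> localZ p"
      using d[OF that] localZ_power[OF localZ_of_int[of "- 1"]]
      by (intro localZ_mult) auto
    moreover have "(- 1 :: rat) ^ (m - j) * (- 1) ^ (m - j) = 1" by (simp flip: power_mult_distrib)
    ultimately show ?thesis by (simp add: mult_ac)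
  qed
  \<comment> \<open>The value at 1 is the constant coefficient in the shifted basis.\<close>
  have P1: "poly P 1 / q \<in> localZ p"
    using A[of 0] by (simp only: P_def poly_bernoulli_poly_1 even) simp
  have diff: "(poly P 0 - poly P 1) / q = fact m / q * (\<Sum>i<m. log_coeff K i)"
    unfolding P_def poly_bernoulli_poly_0 poly_bernoulli_poly_1 even
    by (simp add: lessThan_Suc_atMost[symmetric] algebra_simps)
  have t: "of_nat (Suc K) / of_nat (Suc K + m) \<in> localZ p"
    using quotient_localZ[OF le] by (simp del: of_nat_Suc)
  have "(poly P 0 - poly P 1) / q / of_nat p \<in> localZ p"
    unfolding diff by (rule log_coeff_sum_divisible[OF odd m _ t]) (rule A)
  then have nu: "nu p (poly P 1) = ereal (- real_of_int (max_pole p P)) \<longleftrightarrow>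
      nu p (poly P 0) = ereal (- real_of_int (max_pole p P))"
    using nu_cong_mod_p[OF P1[unfolded q_def]] by (simp add: q_def)
  have pos: "((K + m) choose K) > 0" by simp
  have "int (K + m) + 1 = int (Suc (K + m))" by simp
  then have S: "SAMZC p (K + m) K \<longleftrightarrow> nu p (poly P 1) = ereal (- real_of_int (max_pole p P))"
    unfolding SAMZC_def stirling_eq_choose_bernoulli_1
    by (simp only: even mult_1_left add_diff_cancel_left' nu_choose_mult_iff[OF pos] flip: P_def)
  have A: "AMZC p (Suc (K + m)) (Suc K) \<longleftrightarrow> nu p (poly P 0) = ereal (- real_of_int (max_pole p P))"
    unfolding AMZC_def stirling_eq_choose_bernoulli_0
    by (simp only: even mult_1_left diff_Suc_Suc diff_Suc_1 add_diff_cancel_left' nu_choose_mult_iff[OF pos] flip: P_def)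
  show "SAMZC p (K + m) K \<longleftrightarrow> AMZC p (Suc (K + m)) (Suc K)"
    using S A nu by simp
  show "nu p (of_nat (stirling (Suc (K + m)) (Suc K))) = nu p (of_nat (stirling (K + m) K))"
    if "SAMZC p (K + m) K" "AMZC p (Suc (K + m)) (Suc K)"
    using that S A by (simp add: stirling_eq_choose_bernoulli_1 stirling_eq_choose_bernoulli_0 even
        nu_mult P_def del: stirling.simps)
qed

end

theorem theorem4p8:
  fixes p n k r :: nat
  assumes "prime p" and "odd p"
    and "1 \<le> k" and "k \<le> n"
    and "n - k = r * (p - 1)"
  shows "(MZC p n k \<longleftrightarrow> \<not> p dvd ((k - 1) choose r)) \<and>
         (SMZC p n k \<longleftrightarrow> \<not> p dvd (k choose r)) \<and>
         (nu p (of_nat n) \<le> nu p (of_nat k) \<longrightarrow>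
           (SAMZC p (n - 1) (k - 1) \<longleftrightarrow> AMZC p n k) \<and>
           (SAMZC p (n - 1) (k - 1) \<and> AMZC p n k \<longrightarrow>
              nu p (of_nat (stirling n k)) = nu p (of_nat (stirling (n - 1) (k - 1))))) \<and>
         (nu p (of_nat k) < nu p (of_nat n) \<longrightarrow>
           (SAMZC p n k \<longleftrightarrow> AMZC p (n + 1) (k + 1)) \<and>
           (SAMZC p n k \<and> AMZC p (n + 1) (k + 1) \<longrightarrow>
              nu p (of_nat (stirling n k)) = nu p (of_nat (stirling (n + 1) (k + 1)))))"
proof -
  define K where "K = k - 1"
  define m where "m = n - k"
  have m: "m = r * (p - 1)" using assms(5) by (simp add: m_def)
  have k: "k = Suc K" and n: "n = Suc (K + m)" using assms(3,4) by (simp_all add: K_def m_def)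
  have a: "MZC p n k \<longleftrightarrow> \<not> p dvd ((k - 1) choose r)"
  proof -
    have "of_nat (stirling n k) = fact (K + m) / fact K * (\<Sum>i\<le>m. log_coeff K i)"
      by (simp add: sum_log_coeff n k del: stirling.simps)
    then have "MZC p n k \<longleftrightarrow> nu p (\<Sum>i\<le>m. log_coeff K i) = ereal (- real r)"
      using nu_fact_quotient_mult_iff[OF assms(1), of K "K + m" r] m
      by (simp add: MZC_def n k del: stirling.simps)
    also have "\<dots> \<longleftrightarrow> \<not> p dvd ((k - 1) choose r)"
      using nu_eq_minus_iff[OF assms(1) sum_log_coeff_cong_choose[OF assms(1)]] by (simp add: m k)
    finally show ?thesis .
  qed
  have b: "SMZC p n k \<longleftrightarrow> \<not> p dvd (k choose r)"
  proof -
    \<comment> \<open>With the power k instead of K = k - 1, s(n, k) is a single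
      coefficient.\<close>
    have "of_nat (stirling n k) = fact n / fact k * log_coeff k m"
      by (simp add: log_coeff_stirling n k del: stirling.simps fact_Suc)
    then have "SMZC p n k \<longleftrightarrow> nu p (log_coeff k m) = ereal (- real r)"
      using nu_fact_quotient_mult_iff[OF assms(1,4,5)] by (simp add: SMZC_def)
    also have "\<dots> \<longleftrightarrow> \<not> p dvd (k choose r)"
      using nu_eq_minus_iff[OF assms(1) log_coeff_cong_choose[OF assms(1)]] by (simp add: m)
    finally show ?thesis .
  qed
  have c: "(SAMZC p (n - 1) (k - 1) \<longleftrightarrow> AMZC p n k) \<and>
      (SAMZC p (n - 1) (k - 1) \<and> AMZC p n k \<longrightarrow>
        nu p (of_nat (stirling n k)) = nu p (of_nat (stirling (n - 1) (k - 1))))"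
    if "nu p (of_nat n) \<le> nu p (of_nat k)"
    using AMZC_iff_SAMZC[OF assms(1,2) m, of K] that by (simp add: n k del: stirling.simps of_nat_Suc)
  have d: "(SAMZC p n k \<longleftrightarrow> AMZC p (n + 1) (k + 1)) \<and>
      (SAMZC p n k \<and> AMZC p (n + 1) (k + 1) \<longrightarrow>
        nu p (of_nat (stirling n k)) = nu p (of_nat (stirling (n + 1) (k + 1))))"
    if lt: "nu p (of_nat k) < nu p (of_nat n)"
  proof -
    have nu: "nu p (of_nat (Suc l)) = ereal (real (multiplicity p (Suc l)))" for l
      using rat_val_of_nat[OF assms(1), of "Suc l"] by (simp add: nu_def del: of_nat_Suc)
    have "multiplicity p n > 0" using lt unfolding n k nu by simp
    then have "p dvd n" using not_dvd_imp_multiplicity_0 by fastforce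
    then have "\<not> p dvd Suc n"
      using assms(1) by (metis Suc_eq_plus1 dvd_add_right_iff nat_dvd_1_iff_1 not_prime_1)
    \<comment> \<open>The left side is 0, so the argument for (c) applies one step higher.\<close>
    then have "nu p (of_nat (Suc n)) \<le> nu p (of_nat (Suc k))"
      unfolding nu by (simp add: not_dvd_imp_multiplicity_0)
    moreover have "n = k + m" using assms(4) by (simp add: m_def)
    ultimately show ?thesis
      using AMZC_iff_SAMZC[OF assms(1,2) m, of k] by (simp del: stirling.simps of_nat_Suc)
  qed
  show ?thesis using a b c d by blast
qed

end
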